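(* Let $d$ and $n$ be positive integers, and let $w_d(n)=\nu_2(W_d(n))$, where $W_d(n)$ is the number of $2n$-step walks in $\mathbb{Z}^d$ that begin and end at the origin, each step being a move by one of the $2d$ vectors $\pm \mathbf{e}_1,\dots,\pm\mathbf{e}_d$. Let $s_2(n)$ be the number of $1$s in the binary expansion of $n$. Then: (a) If $\nu_2(d)=0$, then $w_d(n)=s_2(n)$. (b) If $\nu_2(d)=1$, then $w_d(n)=2s_2(n)$. (c) If $\nu_2(d)=2$, then $w_d(n)\ge 3s_2(n)$, with equality if and only if the binary expansion of $n$ does not contain two adjacent $1$s. (d) If $\nu_2(d)\ge 3$, let $\delta=\nu_2(d)-2$. Then $w_d(n)\ge 3s_2(n)+\delta$, with equality if and only if, in the binary expansion of $n$, all of the $1$s come before all of the $0$s.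
   Context: $\nu_2(x)$ denotes the exponent of $2$ in the prime factorisation of a positive integer $x$. The binary expansion of $n$ is written without leading zeroes. *)

theory Defs
  imports
    Complex_Main
    "HOL-Library.Function_Algebras"
    "HOL-Computational_Algebra.Primes"
begin

text \<open>
  A point of \<open>\<int>\<^sup>d\<close> is a function \<open>nat \<Rightarrow> int\<close> that vanishes outside the \<open>d\<close> coordinates
  \<open>{0..<d}\<close>; addition, subtraction, negation and the origin \<open>0\<close> are pointwise.
\<close>

definition lattice :: "nat \<Rightarrow> (nat \<Rightarrow> int) set" where
  "lattice d = {x. \<forall>i\<ge>d. x i = 0}"

definition unit_vec :: "nat \<Rightarrow> nat \<Rightarrow> int" where
  "unit_vec i = (\<lambda>j. if j = i then 1 else 0)"

definition steps :: "nat \<Rightarrow> (nat \<Rightarrow> int) set" where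
  "steps d = {unit_vec i | i. i < d} \<union> {- unit_vec i | i. i < d}"

text \<open>
  A walk is the list of the points it visits, so an \<open>N\<close>-step walk has \<open>N + 1\<close> entries.
\<close>

definition closed_walks :: "nat \<Rightarrow> nat \<Rightarrow> (nat \<Rightarrow> int) list set" where
  "closed_walks d N = {p. length p = N + 1 \<and> set p \<subseteq> lattice d \<and> p ! 0 = 0 \<and> p ! N = 0 \<and>
     (\<forall>k<N. p ! Suc k - p ! k \<in> steps d)}"

definition W :: "nat \<Rightarrow> nat \<Rightarrow> nat" where
  "W d n = card (closed_walks d (2 * n))"

definition w :: "nat \<Rightarrow> nat \<Rightarrow> nat" where
  "w d n = multiplicity 2 (W d n)"

text \<open>
  The digits are listed with the most significant one first; the expansion of \<open>0\<close> is empty.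
\<close>

fun binary_expansion :: "nat \<Rightarrow> nat list" where
  "binary_expansion n = (if n = 0 then [] else binary_expansion (n div 2) @ [n mod 2])"

declare binary_expansion.simps [simp del]

definition s2 :: "nat \<Rightarrow> nat" where
  "s2 n = count_list (binary_expansion n) 1"

definition has_adjacent_ones :: "nat list \<Rightarrow> bool" where
  "has_adjacent_ones ds \<longleftrightarrow> (\<exists>i. Suc i < length ds \<and> ds ! i = 1 \<and> ds ! Suc i = 1)"

definition ones_before_zeros :: "nat list \<Rightarrow> bool" where
  "ones_before_zeros ds \<longleftrightarrow>
     (\<forall>i<length ds. \<forall>j<length ds. ds ! i = 1 \<and> ds ! j = 0 \<longrightarrow> i < j)"

end

theory Submission
  imports
    Defs
    "HOL-Number_Theory.Cong"
    "HOL-Computational_Algebra.Formal_Power_Series"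
begin

text \<open>
  Splitting a closed walk by coordinates gives \<open>W d n = binom(2n, n) V d n\<close>, where \<open>V d n\<close> is \<open>n!\<^sup>2\<close>
  times the coefficient of \<open>y\<^sup>n\<close> in \<open>(\<Sum>k. y\<^sup>k / k!\<^sup>2)\<^sup>d\<close>; the factor \<open>binom(2n, n)\<close> has valuation \<open>s2 n\<close>.
  Everything rests on \<open>d = 4\<close>, where
  \<open>V 4 n = \<Sum>j. binom(n + j, j) binom(n, 2j) binom(2j, j)\<^sup>2 4\<^sup>n\<^sup>-\<^sup>2\<^sup>j\<close>. Modulo \<open>2\<close> times \<open>4\<close> to the power \<open>s2 n\<close>
  only \<open>j = n div 2\<close> survives, and this term carries the factor \<open>binom(n + n div 2, n div 2)\<close>, which is
  odd exactly if \<open>n\<close> has no two adjacent ones.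

  The other \<open>d\<close> follow from the convolution formula for \<open>V (d + e)\<close>. Adding \<open>2\<close>, \<open>4\<close>, \<open>8\<close> to an odd
  multiple of \<open>1\<close>, \<open>2\<close>, \<open>4\<close> does not change the valuation in question. For \<open>V (2 d)\<close> the terms \<open>k\<close> and
  \<open>n - k\<close> pair up: passing from \<open>4\<close> to \<open>8\<close> one counts modulo \<open>4\<close> the splittings of the ones of \<open>n\<close> into two
  sets without adjacent ones (two for each run of ones), and from \<open>8\<close> on only the terms \<open>k = 0\<close> and
  \<open>k = n\<close> matter.
\<close>

section \<open>Binary digit sums and carries\<close>

lemma binary_expansion_0 [simp]: "binary_expansion 0 = []"
  by (simp add: binary_expansion.simps)

lemma binary_expansion_double: "m > 0 \<Longrightarrow> binary_expansion (2 * m) = binary_expansion m @ [0]"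
  by (subst binary_expansion.simps) simp

lemma binary_expansion_Suc_double: "binary_expansion (Suc (2 * m)) = binary_expansion m @ [1]"
  by (subst binary_expansion.simps) simp

lemma s2_0 [simp]: "s2 0 = 0"
  by (simp add: s2_def)

lemma s2_double [simp]: "s2 (2 * m) = s2 m"
  by (cases "m = 0") (simp_all add: s2_def binary_expansion_double)

lemma s2_Suc_double [simp]: "s2 (Suc (2 * m)) = Suc (s2 m)"
  by (simp add: s2_def binary_expansion_Suc_double)

lemma nat_parity_cases [case_names even odd]:
  obtains m where "n = 2 * m" | m where "n = Suc (2 * m)"
  by (metis evenE oddE Suc_eq_plus1)

text \<open>Induction on the binary digits, appending the lowest one. The condition
  \<open>m > 0\<close> keeps out \<open>0 = 2 * 0\<close>, that is, a leading zero.\<close>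

lemma parity_induct [case_names zero even odd]:
  fixes P :: "nat \<Rightarrow> bool"
  assumes "P 0" and "\<And>m. m > 0 \<Longrightarrow> P m \<Longrightarrow> P (2 * m)" and "\<And>m. P m \<Longrightarrow> P (Suc (2 * m))"
  shows "P n"
proof (induction n rule: less_induct)
  case (less n)
  show ?case
  proof (cases n rule: nat_parity_cases)
    case (even m)
    then show ?thesis using assms(1) assms(2)[of m] less[of m] by (cases "m = 0") auto
  next
    case (odd m)
    then show ?thesis using assms(3)[of m] less[of m] by auto
  qed
qed

lemma s2_pos: "n > 0 \<Longrightarrow> s2 n > 0"
  by (induction n rule: parity_induct) auto

lemma s2_le: "s2 n \<le> n"
  by (induction n rule: parity_induct) auto

lemma s2_less: "n \<ge> 2 \<Longrightarrow> s2 n < n"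
proof -
  assume "n \<ge> 2"
  then obtain m where "n = 2 * m \<or> n = Suc (2 * m)" "m > 0"
    by (cases n rule: nat_parity_cases) auto
  with s2_le[of m] show ?thesis by auto
qed

text \<open>Incrementing \<open>n\<close> clears its trailing ones and sets the next digit; the
  number of cleared ones is the valuation of \<open>Suc n\<close>.\<close>

lemma multiplicity_Suc_plus_s2: "multiplicity 2 (Suc n) + s2 (Suc n) = Suc (s2 n)"
proof (induction n rule: less_induct)
  case (less n)
  show ?case
  proof (cases n rule: nat_parity_cases)
    case (even m)
    then show ?thesis by (simp add: not_dvd_imp_multiplicity_0)
  next
    case (odd m)
    then have "Suc n = 2 * Suc m" by simp
    moreover have "multiplicity 2 (2 * Suc m) = Suc (multiplicity 2 (Suc m))"
      by (rule multiplicity_times_same) auto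
    moreover have "multiplicity 2 (Suc m) + s2 (Suc m) = Suc (s2 m)" using less[of m] odd by simp
    ultimately have "multiplicity 2 (Suc n) + s2 (Suc n) = Suc (Suc (s2 m))"
      by (simp only: s2_double add_Suc)
    then show ?thesis using odd by simp
  qed
qed

text \<open>Legendre's formula for the prime 2, accumulated from the previous lemma; the additive
  form avoids truncated subtraction.\<close>

lemma multiplicity_fact_plus_s2: "multiplicity 2 (fact n :: nat) + s2 n = n"
proof (induction n)
  case (Suc n)
  have "multiplicity 2 (fact (Suc n) :: nat) = multiplicity 2 (Suc n) + multiplicity 2 (fact n :: nat)"
    by (simp add: prime_elem_multiplicity_mult_distrib del: mult_Suc)
  then show ?case using Suc multiplicity_Suc_plus_s2[of n] by simp
qed simp

text \<open>Kummer's theorem for the prime 2: each carry in \<open>a + b\<close> costs one digit 1.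
  It follows from Legendre's formula for the three factorials.\<close>

lemma multiplicity_binomial_plus_s2:
  "multiplicity 2 ((a + b) choose a) + s2 (a + b) = s2 a + s2 b"
proof -
  have "fact a * fact b * ((a + b) choose a) = (fact (a + b) :: nat)"
    using binomial_fact_lemma[of a "a + b"] by simp
  then have "multiplicity 2 (fact (a + b) :: nat) =
     multiplicity 2 (fact a :: nat) + multiplicity 2 (fact b :: nat) + multiplicity 2 ((a + b) choose a)"
    by (simp add: prime_elem_multiplicity_mult_distrib flip: \<open>_ = fact (a + b)\<close>)
  then show ?thesis
    using multiplicity_fact_plus_s2[of a] multiplicity_fact_plus_s2[of b]
      multiplicity_fact_plus_s2[of "a + b"] by linarith
qed

lemma s2_add_le: "s2 (a + b) \<le> s2 a + s2 b"
  using multiplicity_binomial_plus_s2[of a b] by simp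

lemma multiplicity_central_binomial: "multiplicity 2 ((2 * n) choose n) = s2 n"
  using multiplicity_binomial_plus_s2[of n n] by (simp flip: mult_2)

text \<open>By Kummer's theorem this means that no binary position holds a one in both
  numbers.\<close>

definition carry_free :: "nat \<Rightarrow> nat \<Rightarrow> bool" where
  "carry_free a b \<longleftrightarrow> s2 (a + b) = s2 a + s2 b"

lemma odd_binomial_iff: "odd ((a + b) choose a) \<longleftrightarrow> carry_free a b"
proof -
  have "odd ((a + b) choose a) \<longleftrightarrow> multiplicity 2 ((a + b) choose a) = 0"
    by (subst multiplicity_eq_zero_iff) auto
  then show ?thesis using multiplicity_binomial_plus_s2[of a b] by (auto simp: carry_free_def)
qed

lemma carry_free_simps [simp]:
  "carry_free (2 * a) (2 * b) \<longleftrightarrow> carry_free a b"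
  "carry_free (Suc (2 * a)) (2 * b) \<longleftrightarrow> carry_free a b"
  "carry_free (2 * a) (Suc (2 * b)) \<longleftrightarrow> carry_free a b"
  "\<not> carry_free (Suc (2 * a)) (Suc (2 * b))"
proof -
  show "carry_free (2 * a) (2 * b) \<longleftrightarrow> carry_free a b"
    using s2_double[of "a + b"] s2_Suc_double[of "a + b"] by (simp add: carry_free_def)
  show "carry_free (Suc (2 * a)) (2 * b) \<longleftrightarrow> carry_free a b"
    using s2_double[of "a + b"] s2_Suc_double[of "a + b"] by (simp add: carry_free_def)
  show "carry_free (2 * a) (Suc (2 * b)) \<longleftrightarrow> carry_free a b"
    using s2_double[of "a + b"] s2_Suc_double[of "a + b"] by (simp add: carry_free_def)
  \<comment> \<open>The two lowest ones merge into a single carried one, so the digit sum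
    drops.\<close>
  have "Suc (2 * a) + Suc (2 * b) = 2 * (a + b + 1)" by simp
  then have "s2 (Suc (2 * a) + Suc (2 * b)) = s2 (a + b + 1)" by (metis s2_double)
  also have "\<dots> \<le> s2 a + s2 b + s2 1"
    using s2_add_le[of "a + b" 1] s2_add_le[of a b] by linarith
  also have "s2 1 = 1" using s2_Suc_double[of 0] by simp
  finally show "\<not> carry_free (Suc (2 * a)) (Suc (2 * b))"
    by (simp add: carry_free_def)
qed

lemma not_carry_free_self: "k > 0 \<Longrightarrow> \<not> carry_free k k"
  using s2_pos[of k] by (simp add: carry_free_def flip: mult_2)

section \<open>Numbers without adjacent ones and numbers whose ones lead\<close>

definition sparse :: "nat \<Rightarrow> bool" where
  "sparse n \<longleftrightarrow> \<not> has_adjacent_ones (binary_expansion n)"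

definition leading_ones :: "nat \<Rightarrow> bool" where
  "leading_ones n \<longleftrightarrow> ones_before_zeros (binary_expansion n)"

text \<open>\<open>binary_expansion\<close> appends the lowest digit at the end, so the digit
  predicates are needed for lists extended on the right.\<close>

lemma has_adjacent_ones_snoc:
  "has_adjacent_ones (ds @ [x]) \<longleftrightarrow> has_adjacent_ones ds \<or> (ds \<noteq> [] \<and> last ds = 1 \<and> x = 1)"
proof
  assume "has_adjacent_ones (ds @ [x])"
  then obtain i where i: "Suc i < Suc (length ds)" "(ds @ [x]) ! i = 1" "(ds @ [x]) ! Suc i = 1"
    by (auto simp: has_adjacent_ones_def)
  show "has_adjacent_ones ds \<or> (ds \<noteq> [] \<and> last ds = 1 \<and> x = 1)"
  proof (cases "Suc i < length ds")
    case True
    then show ?thesis using i by (auto simp: has_adjacent_ones_def nth_append)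
  next
    case False
    then have l: "length ds = Suc i" using i by simp
    then have "ds \<noteq> []" by auto
    then have "last ds = ds ! i" using l by (simp add: last_conv_nth)
    with l \<open>ds \<noteq> []\<close> show ?thesis using i by (simp add: nth_append)
  qed
next
  assume "has_adjacent_ones ds \<or> (ds \<noteq> [] \<and> last ds = 1 \<and> x = 1)"
  then show "has_adjacent_ones (ds @ [x])"
  proof
    assume "has_adjacent_ones ds"
    then obtain i where "Suc i < length ds" "ds ! i = 1" "ds ! Suc i = 1"
      by (auto simp: has_adjacent_ones_def)
    then show ?thesis
      unfolding has_adjacent_ones_def by (intro exI[of _ i]) (simp add: nth_append)
  next
    assume "ds \<noteq> [] \<and> last ds = 1 \<and> x = 1"
    then show ?thesis
      unfolding has_adjacent_ones_def
      by (intro exI[of _ "length ds - 1"]) (auto simp: nth_append last_conv_nth)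
  qed
qed

lemma ones_before_zeros_snoc_0:
  "ones_before_zeros (ds @ [0]) \<longleftrightarrow> ones_before_zeros ds"
proof
  assume *: "ones_before_zeros (ds @ [0])"
  show "ones_before_zeros ds"
    unfolding ones_before_zeros_def
  proof (intro allI impI)
    fix i j assume "i < length ds" "j < length ds" "ds ! i = 1 \<and> ds ! j = 0"
    then show "i < j"
      using *[unfolded ones_before_zeros_def, rule_format, of i j] by (simp add: nth_append)
  qed
next
  assume *: "ones_before_zeros ds"
  show "ones_before_zeros (ds @ [0])"
    unfolding ones_before_zeros_def
  proof (intro allI impI)
    fix i j
    assume ij: "i < length (ds @ [0])" "j < length (ds @ [0])" "(ds @ [0]) ! i = 1 \<and> (ds @ [0]) ! j = 0"
    then have i: "i < length ds" by (cases "i = length ds") auto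
    show "i < j"
    proof (cases "j < length ds")
      case True
      then show ?thesis
        using *[unfolded ones_before_zeros_def, rule_format, of i j] ij i by (simp add: nth_append)
    qed (use i in simp)
  qed
qed

lemma ones_before_zeros_snoc_1:
  "ones_before_zeros (ds @ [1]) \<longleftrightarrow> 0 \<notin> set ds"
proof
  assume *: "ones_before_zeros (ds @ [1])"
  show "0 \<notin> set ds"
  proof
    assume "0 \<in> set ds"
    then obtain j where "j < length ds" "ds ! j = 0" by (auto simp: in_set_conv_nth)
    then have "length ds < j"
      using *[unfolded ones_before_zeros_def, rule_format, of "length ds" j] by (simp add: nth_append)
    with \<open>j < length ds\<close> show False by simp
  qed
next
  assume "0 \<notin> set ds"
  then have "(ds @ [1]) ! j \<noteq> 0" if "j < length (ds @ [1])" for j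
    using nth_mem[OF that] by (metis Un_iff empty_set list.simps(15) set_append singletonD zero_neq_one)
  then show "ones_before_zeros (ds @ [1])" unfolding ones_before_zeros_def by blast
qed

lemma binary_expansion_eq_Nil [simp]: "binary_expansion n = [] \<longleftrightarrow> n = 0"
  by (subst binary_expansion.simps) simp

lemma last_binary_expansion: "n > 0 \<Longrightarrow> last (binary_expansion n) = n mod 2"
  by (subst binary_expansion.simps) simp

lemma sparse_simps [simp]:
  "sparse 0" "sparse (2 * m) \<longleftrightarrow> sparse m" "sparse (Suc (2 * m)) \<longleftrightarrow> even m \<and> sparse m"
proof -
  show "sparse 0" by (simp add: sparse_def has_adjacent_ones_def)
  then show "sparse (2 * m) \<longleftrightarrow> sparse m"
    by (cases "m = 0") (simp_all add: sparse_def binary_expansion_double has_adjacent_ones_snoc)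
  show "sparse (Suc (2 * m)) \<longleftrightarrow> even m \<and> sparse m"
    unfolding sparse_def binary_expansion_Suc_double has_adjacent_ones_snoc
    by (cases "m = 0") (auto simp: last_binary_expansion has_adjacent_ones_def even_iff_mod_2_eq_zero)
qed

lemma leading_ones_double: "leading_ones (2 * m) \<longleftrightarrow> leading_ones m"
  by (cases "m = 0")
    (simp_all add: leading_ones_def binary_expansion_double ones_before_zeros_snoc_0)

lemma leading_ones_1: "leading_ones (Suc 0)"
  using binary_expansion_Suc_double[of 0] by (simp add: leading_ones_def ones_before_zeros_def)

lemma leading_ones_Suc_double: "leading_ones (Suc (2 * m)) \<longleftrightarrow> 0 \<notin> set (binary_expansion m)"
  unfolding leading_ones_def binary_expansion_Suc_double by (rule ones_before_zeros_snoc_1)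

lemma leading_ones_Suc_double_even: "m > 0 \<Longrightarrow> even m \<Longrightarrow> \<not> leading_ones (Suc (2 * m))"
  unfolding leading_ones_Suc_double by (auto simp: binary_expansion_double elim!: evenE)

lemma leading_ones_Suc_double_odd:
  assumes "odd m"
  shows "leading_ones (Suc (2 * m)) \<longleftrightarrow> leading_ones m"
proof -
  from assms obtain l where "m = Suc (2 * l)" by (auto elim: oddE)
  then show ?thesis
    by (simp add: leading_ones_Suc_double binary_expansion_Suc_double del: mult_Suc_right)
qed

lemma carry_free_rec:
  "carry_free a b \<longleftrightarrow> \<not> (odd a \<and> odd b) \<and> carry_free (a div 2) (b div 2)"
  by (cases a rule: nat_parity_cases; cases b rule: nat_parity_cases) simp_all

lemma sparse_rec: "sparse n \<longleftrightarrow> \<not> (odd n \<and> odd (n div 2)) \<and> sparse (n div 2)"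
  by (cases n rule: nat_parity_cases) auto

text \<open>\<open>n div 2\<close> is \<open>n\<close> shifted by one digit, so a position where
  both hold a one is a pair of adjacent ones of \<open>n\<close>.\<close>

lemma sparse_iff_carry_free: "sparse n \<longleftrightarrow> carry_free n (n div 2)"
proof (induction n rule: less_induct)
  case (less n)
  show ?case
  proof (cases "n = 0")
    case True
    then show ?thesis by (simp add: carry_free_def)
  next
    case False
    then show ?thesis using less[of "n div 2"] sparse_rec[of n] carry_free_rec[of n "n div 2"] by simp
  qed
qed

section \<open>Sums of squares of multinomial coefficients\<close>

text \<open>The sum of the squared multinomial coefficients over all ordered ways to write
  \<open>n\<close> as a sum of \<open>d\<close> naturals; the recursion splits off one part,
  \<open>n - k\<close>.\<close>

fun V :: "nat \<Rightarrow> nat \<Rightarrow> nat" where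
  "V 0 n = of_bool (n = 0)"
| "V (Suc d) n = (\<Sum>k\<le>n. (n choose k)\<^sup>2 * V d k)"

lemma V_0_right [simp]: "V d 0 = 1"
  by (induction d) auto

lemma V_pos: "d > 0 \<Longrightarrow> V d n > 0"
proof (induction d)
  case (Suc d)
  have "(n choose 0)\<^sup>2 * V d 0 \<le> V (Suc d) n"
    unfolding V.simps by (rule member_le_sum) auto
  then show ?case by simp
qed simp

lemma V_eq_fps_nth:
  "real (V d n) = (fact n)\<^sup>2 * fps_nth (Abs_fps (\<lambda>k. 1 / (fact k)\<^sup>2) ^ d) n"
proof (induction d arbitrary: n)
  case (Suc d)
  let ?F = "Abs_fps (\<lambda>k. 1 / (fact k)\<^sup>2 :: real)"
  have "real (V (Suc d) n) = (\<Sum>k\<le>n. (real (n choose k))\<^sup>2 * real (V d k))"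
    by simp
  also have "\<dots> = (\<Sum>k\<le>n. (fact n)\<^sup>2 * (fps_nth (?F ^ d) k * fps_nth ?F (n - k)))"
    by (intro sum.cong) (auto simp: Suc.IH binomial_fact field_simps power2_eq_square)
  also have "\<dots> = (fact n)\<^sup>2 * fps_nth (?F ^ Suc d) n"
    by (simp add: power_Suc2 fps_mult_nth sum_distrib_left atMost_atLeast0 del: power_Suc)
  finally show ?case .
qed simp

text \<open>The series to the power \<open>d + e\<close> is a product of two powers; the factorials
  of its Cauchy product combine into squared binomial coefficients.\<close>

lemma V_add: "V (d + e) n = (\<Sum>k\<le>n. (n choose k)\<^sup>2 * V d k * V e (n - k))"
proof -
  let ?F = "Abs_fps (\<lambda>k. 1 / (fact k)\<^sup>2 :: real)"
  have "real (V (d + e) n) = (fact n)\<^sup>2 * (\<Sum>k\<le>n. fps_nth (?F ^ d) k * fps_nth (?F ^ e) (n - k))"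
    by (simp only: V_eq_fps_nth power_add fps_mult_nth atMost_atLeast0)
  also have "\<dots> = (\<Sum>k\<le>n. (real (n choose k))\<^sup>2 * real (V d k) * real (V e (n - k)))"
    unfolding sum_distrib_left
    by (intro sum.cong) (auto simp: V_eq_fps_nth binomial_fact field_simps power2_eq_square)
  also have "\<dots> = real (\<Sum>k\<le>n. (n choose k)\<^sup>2 * V d k * V e (n - k))"
    by simp
  finally show ?thesis by (simp only: of_nat_eq_iff)
qed

lemma V_1: "V (Suc 0) n = 1"
proof -
  have "V (Suc 0) n = (\<Sum>k\<in>{0}. (n choose k)\<^sup>2 * V 0 k)"
    unfolding V.simps(2) by (rule sum.mono_neutral_right) auto
  then show ?thesis by simp
qed

lemma V_2: "V 2 n = (2 * n) choose n"
proof -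
  have "V (Suc (Suc 0)) n = (2 * n) choose n"
    unfolding V.simps(2)[of "Suc 0"] V_1 by (simp add: choose_square_sum)
  then show ?thesis by (simp only: numeral_2_eq_2)
qed

section \<open>Four coordinates: a sum with explicit powers of 4\<close>

lemma V_4: "V 4 n = (\<Sum>k\<le>n. (n choose k)\<^sup>2 * ((2 * k) choose k) * ((2 * (n - k)) choose (n - k)))"
  using V_add[of 2 2 n] by (simp add: V_2)

text \<open>Once \<open>a + b\<close> is fixed, \<open>a\<close> and \<open>b\<close> enter each
  term on the right through separate factors, so summing over \<open>a\<close> gives convolutions.
  The proof expands the first factor by Vandermonde's identity, swaps the sums and applies the
  identity to each of them.\<close>

lemma binomial_square_expansion:
  "((a + b) choose a)\<^sup>2 = (\<Sum>j\<le>a. ((a + b + j) choose j) * (a choose j) * (b choose j))"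
proof -
  \<comment> \<open>Trinomial revision takes \<open>i\<close> out of the sum over \<open>j\<close>
    and leaves a Vandermonde sum.\<close>
  have inner: "(\<Sum>j\<le>a. (a choose j) * (b choose j) * (j choose i)) = (a choose i) * ((a + b - i) choose a)"
    if "i \<le> a" for i
  proof -
    have "(a choose j) * (b choose j) * (j choose i) = (a choose i) * ((b choose j) * ((a - i) choose (a - j)))"
      if "j \<le> a" for j
    proof (cases "i \<le> j")
      case True
      then have "(a choose j) * (j choose i) = (a choose i) * ((a - i) choose (j - i))"
        using that by (rule choose_mult)
      moreover have "(a - i) choose (j - i) = (a - i) choose (a - j)"
        using True that binomial_symmetric[of "j - i" "a - i"] by simp
      ultimately show ?thesis by (simp add: mult_ac)
    next
      case False
      then have "j choose i = 0" "(a - i) choose (a - j) = 0" using that \<open>i \<le> a\<close> by auto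
      then show ?thesis by (simp only: mult_0_right)
    qed
    then have "(\<Sum>j\<le>a. (a choose j) * (b choose j) * (j choose i)) =
        (a choose i) * (\<Sum>j\<le>a. (b choose j) * ((a - i) choose (a - j)))"
      unfolding sum_distrib_left by (intro sum.cong) blast+
    also have "\<dots> = (a choose i) * ((b + (a - i)) choose a)"
      by (simp only: vandermonde)
    finally show ?thesis using that by (simp add: add.commute)
  qed
  \<comment> \<open>Both sides choose disjoint sets of sizes \<open>a\<close> and \<open>i\<close>
    from \<open>a + b\<close> elements; the link is their union, of size
    \<open>a + i\<close>.\<close>
  have outer: "((a + b) choose i) * ((a + b - i) choose a) = ((a + b) choose a) * (b choose i)"
    if "i \<le> a" for i
  proof (cases "i \<le> b")
    case True
    have "((a + b) choose (a + i)) * ((a + i) choose i) = ((a + b) choose i) * ((a + b - i) choose a)"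
      using choose_mult[of i "a + i" "a + b"] True by simp
    moreover have "((a + b) choose (a + i)) * ((a + i) choose a) = ((a + b) choose a) * (b choose i)"
      using choose_mult[of a "a + i" "a + b"] True by simp
    moreover have "(a + i) choose i = (a + i) choose a"
      using binomial_symmetric[of i "a + i"] by simp
    ultimately show ?thesis by simp
  next
    case False
    then have "b choose i = 0" "(a + b - i) choose a = 0" using that by auto
    then show ?thesis by (simp only: mult_0_right)
  qed
  have "(a + b + j) choose j = (\<Sum>i\<le>a. ((a + b) choose i) * (j choose i))" if "j \<le> a" for j
  proof -
    have "(a + b + j) choose j = (\<Sum>i\<le>j. ((a + b) choose i) * (j choose (j - i)))"
      by (rule vandermonde[symmetric])
    also have "\<dots> = (\<Sum>i\<le>j. ((a + b) choose i) * (j choose i))"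
      by (intro sum.cong) (auto simp: binomial_symmetric[symmetric])
    \<comment> \<open>The added terms vanish, and the range no longer depends on \<open>j\<close>,
      as swapping the sums requires.\<close>
    also have "\<dots> = (\<Sum>i\<le>a. ((a + b) choose i) * (j choose i))"
      using that by (intro sum.mono_neutral_left) auto
    finally show ?thesis .
  qed
  then have "(\<Sum>j\<le>a. ((a + b + j) choose j) * (a choose j) * (b choose j)) =
      (\<Sum>j\<le>a. \<Sum>i\<le>a. ((a + b) choose i) * ((a choose j) * (b choose j) * (j choose i)))"
    by (intro sum.cong) (simp_all add: sum_distrib_left sum_distrib_right mult_ac)
  also have "\<dots> = (\<Sum>i\<le>a. ((a + b) choose i) * (\<Sum>j\<le>a. (a choose j) * (b choose j) * (j choose i)))"
    by (subst sum.swap) (simp only: sum_distrib_left)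
  also have "\<dots> = (\<Sum>i\<le>a. ((a + b) choose a) * ((b choose i) * (a choose (a - i))))"
  proof (intro sum.cong refl)
    fix i assume "i \<in> {..a}"
    then have "i \<le> a" by simp
    have "((a + b) choose i) * (\<Sum>j\<le>a. (a choose j) * (b choose j) * (j choose i)) =
        (a choose i) * (((a + b) choose i) * ((a + b - i) choose a))"
      by (simp only: inner[OF \<open>i \<le> a\<close>] mult.left_commute)
    also have "\<dots> = ((a + b) choose a) * ((b choose i) * (a choose (a - i)))"
      by (simp only: outer[OF \<open>i \<le> a\<close>] binomial_symmetric[OF \<open>i \<le> a\<close>] mult_ac)
    finally show "((a + b) choose i) * (\<Sum>j\<le>a. (a choose j) * (b choose j) * (j choose i)) = \<dots>" .
  qed
  also have "\<dots> = ((a + b) choose a) * ((b + a) choose a)"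
    by (simp only: vandermonde flip: sum_distrib_left)
  finally show ?thesis by (simp add: power2_eq_square add.commute)
qed

lemma central_binomial_Suc:
  "real (Suc m) * real ((2 * Suc m) choose Suc m) = 2 * (2 * real m + 1) * real ((2 * m) choose m)"
proof -
  have "real ((2 * Suc m) choose Suc m) = fact (2 * Suc m) / (fact (Suc m) * fact (Suc m))"
    by (subst binomial_fact) simp_all
  also have "(fact (2 * Suc m) :: real) = (2 * real m + 2) * (2 * real m + 1) * fact (2 * m)"
    by (simp add: algebra_simps)
  also have "(fact (Suc m) :: real) = (real m + 1) * fact m"
    by (simp add: algebra_simps)
  also have "(2 * real m + 2) * (2 * real m + 1) * fact (2 * m) / ((real m + 1) * fact m * ((real m + 1) * fact m)) =
      2 * (2 * real m + 1) / (real m + 1) * (fact (2 * m) / (fact m * fact m))"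
    by (simp add: divide_simps) (simp add: algebra_simps)
  also have "fact (2 * m) / (fact m * fact m) = real ((2 * m) choose m)"
    by (subst binomial_fact) simp_all
  finally have "real ((2 * Suc m) choose Suc m) =
     2 * (2 * real m + 1) / (real m + 1) * real ((2 * m) choose m)" .
  then show ?thesis
    by (simp only: of_nat_Suc times_divide_eq_left) (simp add: add.commute del: binomial_Suc_Suc mult_Suc_right)
qed

text \<open>The right side is the coefficient of y^i in binom(2j, j) (1 - 4y)^(-(j + 1/2)). The
  induction compares ratios of consecutive terms.\<close>

lemma binomial_times_central_binomial:
  "real ((j + i) choose j) * real ((2 * (j + i)) choose (j + i)) =
     real ((2 * j) choose j) * 4 ^ i * pochhammer (real j + 1 / 2) i / fact i"
proof (induction i)
  case (Suc i)
  let ?m = "j + i"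
  have cancel: "(x / y * a) * (z / x * b) = z / y * (a * b)" if "x \<noteq> 0" for x y z a b :: real
    using that by simp
  have 1: "real ((j + Suc i) choose j) = real (Suc ?m) / real (Suc i) * real (?m choose j)"
    by (simp add: binomial_fact divide_simps del: binomial_Suc_Suc)
  have 2: "real ((2 * (j + Suc i)) choose (j + Suc i)) =
     2 * (2 * real ?m + 1) / real (Suc ?m) * real ((2 * ?m) choose ?m)"
    using central_binomial_Suc[of ?m] by (simp add: field_simps del: binomial_Suc_Suc)
  have "real ((j + Suc i) choose j) * real ((2 * (j + Suc i)) choose (j + Suc i)) =
    2 * (2 * real ?m + 1) / real (Suc i) * (real (?m choose j) * real ((2 * ?m) choose ?m))"
    unfolding 1 2 by (rule cancel) simp
  also have "\<dots> = real ((2 * j) choose j) * 4 ^ Suc i * pochhammer (real j + 1 / 2) (Suc i) / fact (Suc i)"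
  proof -
    have "4 * (real j + 1 / 2 + real i) = 2 * (2 * real ?m + 1)" by (simp add: algebra_simps)
    moreover have "4 ^ Suc i * pochhammer (real j + 1 / 2) (Suc i) =
        4 * (real j + 1 / 2 + real i) * (4 ^ i * pochhammer (real j + 1 / 2) i)"
      by (simp add: pochhammer_Suc)
    ultimately have "4 ^ Suc i * pochhammer (real j + 1 / 2) (Suc i) =
        2 * (2 * real ?m + 1) * (4 ^ i * pochhammer (real j + 1 / 2) i)" by (simp only:)
    then show ?thesis unfolding Suc.IH by (simp only: fact_Suc mult.assoc) (simp add: mult_ac)
  qed
  finally show ?case .
qed simp

text \<open>
  The generating function of \<open>binom(k, j) binom(2k, k)\<close> is \<open>binom(2j, j) y\<^sup>j\<close> times \<open>(1 - 4y)\<close> to the power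
  \<open>- (j + 1/2)\<close>, so its square has an exponent \<open>- (2j + 1)\<close> and binomial coefficients.
\<close>

lemma sum_central_binomial_convolution:
  "(\<Sum>k\<le>n. (k choose j) * ((n - k) choose j) * ((2 * k) choose k) * ((2 * (n - k)) choose (n - k))) =
     (n choose (2 * j)) * ((2 * j) choose j)\<^sup>2 * 4 ^ (n - 2 * j)"
proof (cases "2 * j \<le> n")
  case False
  have "k < j \<or> n - k < j" if "k \<le> n" for k using False by linarith
  then have "(\<Sum>k\<le>n. (k choose j) * ((n - k) choose j) * ((2 * k) choose k) * ((2 * (n - k)) choose (n - k))) = 0"
    by (intro sum.neutral) auto
  moreover have "n choose (2 * j) = 0" using False by simp
  ultimately show ?thesis by (simp only: mult_0)
next
  case True
  then obtain m where n: "n = 2 * j + m" using le_Suc_ex by blast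
  let ?f = "\<lambda>k. (k choose j) * ((n - k) choose j) * ((2 * k) choose k) * ((2 * (n - k)) choose (n - k))"
  let ?p = "pochhammer (real j + 1 / 2)"
  \<comment> \<open>Outside this range \<open>k choose j\<close> or \<open>(n - k) choose j\<close>
    is zero.\<close>
  have "(\<Sum>k\<le>n. ?f k) = (\<Sum>k\<in>{j..j + m}. ?f k)"
    by (rule sum.mono_neutral_right) (auto simp: n)
  also have "\<dots> = (\<Sum>i\<le>m. ?f (j + i))"
    by (rule sum.reindex_bij_witness[of _ "\<lambda>i. j + i" "\<lambda>k. k - j"]) auto
  finally have "real (\<Sum>k\<le>n. ?f k) = (\<Sum>i\<le>m. real (?f (j + i)))" by simp
  also have "\<dots> = (\<Sum>i\<le>m. (real ((2 * j) choose j))\<^sup>2 * 4 ^ m / fact m * (real (m choose i) * ?p i * ?p (m - i)))"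
  proof (intro sum.cong refl)
    fix i assume "i \<in> {..m}"
    then have i: "i \<le> m" by simp
    then have ni: "n - (j + i) = j + (m - i)" by (simp add: n)
    have "real (?f (j + i)) = (real ((j + i) choose j) * real ((2 * (j + i)) choose (j + i))) *
      (real ((j + (m - i)) choose j) * real ((2 * (j + (m - i))) choose (j + (m - i))))"
      unfolding ni by (simp only: of_nat_mult mult_ac)
    also have "\<dots> = (real ((2 * j) choose j))\<^sup>2 * (4 ^ i * 4 ^ (m - i)) * (?p i * ?p (m - i)) / (fact i * fact (m - i))"
      unfolding binomial_times_central_binomial by (simp add: power2_eq_square)
    also have "(4::real) ^ i * 4 ^ (m - i) = 4 ^ m"
      using i by (simp flip: power_add)
    also have "(real ((2 * j) choose j))\<^sup>2 * 4 ^ m * (?p i * ?p (m - i)) / (fact i * fact (m - i)) =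
      (real ((2 * j) choose j))\<^sup>2 * 4 ^ m / fact m * (real (m choose i) * ?p i * ?p (m - i))"
      using i by (simp add: binomial_fact)
    finally show "real (?f (j + i)) = \<dots>" .
  qed
  \<comment> \<open>The Chu-Vandermonde identity for rising factorials; the two parameters
    \<open>j + 1/2\<close> add up to \<open>2j + 1\<close>.\<close>
  also have "\<dots> = (real ((2 * j) choose j))\<^sup>2 * 4 ^ m / fact m * pochhammer (1 + real (2 * j)) m"
    using pochhammer_binomial_sum[of "real j + 1 / 2" "real j + 1 / 2" m]
    unfolding sum_distrib_left[symmetric] by (simp add: add_ac)
  also have "pochhammer (1 + real (2 * j)) m = fact n / fact (2 * j)"
    using pochhammer_product'[of "1 :: real" "2 * j" m] by (simp add: n flip: pochhammer_fact)
  also have "(real ((2 * j) choose j))\<^sup>2 * 4 ^ m / fact m * (fact n / fact (2 * j)) =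
      real ((n choose (2 * j)) * ((2 * j) choose j)\<^sup>2 * 4 ^ (n - 2 * j))"
    using binomial_fact[of "2 * j" n, where ?'a = real] by (simp add: n mult_ac)
  finally show ?thesis by (simp only: of_nat_eq_iff)
qed

text \<open>Expanding the square in \<open>V_4\<close> and swapping the sums leaves, for each
  \<open>j\<close>, the convolution just evaluated.\<close>

lemma V_4_alt:
  "V 4 n = (\<Sum>j\<le>n. ((n + j) choose j) * (n choose (2 * j)) * ((2 * j) choose j)\<^sup>2 * 4 ^ (n - 2 * j))"
proof -
  have "(n choose k)\<^sup>2 = (\<Sum>j\<le>n. ((n + j) choose j) * (k choose j) * ((n - k) choose j))" if "k \<le> n" for k
  proof -
    have "(n choose k)\<^sup>2 = (\<Sum>j\<le>k. ((n + j) choose j) * (k choose j) * ((n - k) choose j))"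
      using binomial_square_expansion[of k "n - k"] that by simp
    also have "\<dots> = (\<Sum>j\<le>n. ((n + j) choose j) * (k choose j) * ((n - k) choose j))"
      using that by (intro sum.mono_neutral_left) auto
    finally show ?thesis .
  qed
  then have "V 4 n = (\<Sum>k\<le>n. \<Sum>j\<le>n. ((n + j) choose j) *
      ((k choose j) * ((n - k) choose j) * ((2 * k) choose k) * ((2 * (n - k)) choose (n - k))))"
    unfolding V_4 by (intro sum.cong) (simp_all add: sum_distrib_right sum_distrib_left mult_ac)
  also have "\<dots> = (\<Sum>j\<le>n. ((n + j) choose j) *
      (\<Sum>k\<le>n. (k choose j) * ((n - k) choose j) * ((2 * k) choose k) * ((2 * (n - k)) choose (n - k))))"
    by (subst sum.swap) (simp only: sum_distrib_left)
  finally show ?thesis unfolding sum_central_binomial_convolution by (simp only: mult.assoc)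
qed

section \<open>Counting closed walks\<close>

text \<open>The endpoint is left free because removing the last step of a closed walk moves
  it.\<close>

definition walks :: "nat \<Rightarrow> nat \<Rightarrow> (nat \<Rightarrow> int) \<Rightarrow> (nat \<Rightarrow> int) list set" where
  "walks d N x = {p. length p = N + 1 \<and> set p \<subseteq> lattice d \<and> p ! 0 = 0 \<and> p ! N = x \<and>
     (\<forall>k<N. p ! Suc k - p ! k \<in> steps d)}"

lemma steps_eq: "steps d = unit_vec ` {..<d} \<union> (\<lambda>i. - unit_vec i) ` {..<d}"
  by (auto simp: steps_def)

lemma finite_steps [simp]: "finite (steps d)"
  by (simp add: steps_eq)

lemma unit_vec_eq_iff: "unit_vec i = unit_vec j \<longleftrightarrow> i = j"
  by (auto simp: unit_vec_def fun_eq_iff split: if_splits)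

lemma unit_vec_neq_uminus: "unit_vec i \<noteq> - unit_vec j"
proof
  assume "unit_vec i = - unit_vec j"
  then have "unit_vec i i = - unit_vec j i" by simp
  then show False by (simp add: unit_vec_def split: if_splits)
qed

lemma sum_steps: "(\<Sum>s\<in>steps d. f s) = (\<Sum>i<d. f (unit_vec i) + f (- unit_vec i))"
proof -
  have "(\<Sum>s\<in>steps d. f s) = (\<Sum>s\<in>unit_vec ` {..<d}. f s) + (\<Sum>s\<in>(\<lambda>i. - unit_vec i) ` {..<d}. f s)"
    unfolding steps_eq using unit_vec_neq_uminus by (intro sum.union_disjoint) auto
  then show ?thesis
    by (simp add: sum.reindex inj_on_def unit_vec_eq_iff sum.distrib)
qed

lemma lattice_diff_step: "x \<in> lattice d \<Longrightarrow> s \<in> steps d \<Longrightarrow> x - s \<in> lattice d"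
  by (auto simp: lattice_def steps_def unit_vec_def)

lemma walks_0: "x \<in> lattice d \<Longrightarrow> walks d 0 x = (if x = 0 then {[0]} else {})"
  by (auto simp: walks_def length_Suc_conv)

lemma walks_Suc:
  assumes "x \<in> lattice d"
  shows "walks d (Suc N) x = (\<lambda>p. p @ [x]) ` (\<Union>s\<in>steps d. walks d N (x - s))"
proof (intro equalityI subsetI)
  fix p assume p: "p \<in> walks d (Suc N) x"
  then have len: "length p = Suc (Suc N)" by (simp add: walks_def)
  then have "p \<noteq> []" by auto
  then have app: "p = butlast p @ [x]"
    using p len append_butlast_last_id[of p] last_conv_nth[of p] by (simp add: walks_def)
  have nth: "butlast p ! k = p ! k" if "k \<le> N" for k using len that by (simp add: nth_butlast)
  have "butlast p \<in> walks d N (x - (x - p ! N))"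
    using p len nth in_set_butlastD[of _ p] by (auto simp: walks_def)
  moreover have "x - p ! N \<in> steps d" using p by (auto simp: walks_def)
  ultimately show "p \<in> (\<lambda>p. p @ [x]) ` (\<Union>s\<in>steps d. walks d N (x - s))"
    using app by blast
next
  fix p assume "p \<in> (\<lambda>p. p @ [x]) ` (\<Union>s\<in>steps d. walks d N (x - s))"
  then obtain q s where p: "p = q @ [x]" and s: "s \<in> steps d" and q: "q \<in> walks d N (x - s)" by blast
  from q have len: "length q = Suc N" and qN: "q ! N = x - s" by (auto simp: walks_def)
  have "p ! Suc k - p ! k \<in> steps d" if "k < Suc N" for k
  proof (cases "k = N")
    case True
    then show ?thesis using s len qN by (simp add: p nth_append)
  next
    case False
    then show ?thesis using q len that by (simp add: p nth_append walks_def)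
  qed
  then show "p \<in> walks d (Suc N) x"
    using q len assms by (auto simp: p walks_def nth_append)
qed

lemma finite_walks: "x \<in> lattice d \<Longrightarrow> finite (walks d N x)"
proof (induction N arbitrary: x)
  case 0
  then show ?case by (simp add: walks_0)
next
  case (Suc N)
  have "finite (walks d N (x - s))" if "s \<in> steps d" for s
    using Suc.IH lattice_diff_step[OF Suc.prems that] .
  then show ?case unfolding walks_Suc[OF Suc.prems] by simp
qed

lemma card_walks_Suc:
  assumes "x \<in> lattice d"
  shows "card (walks d (Suc N) x) =
    (\<Sum>i<d. card (walks d N (x - unit_vec i)) + card (walks d N (x + unit_vec i)))"
proof -
  have "card (walks d (Suc N) x) = card (\<Union>s\<in>steps d. walks d N (x - s))"
    unfolding walks_Suc[OF assms] by (rule card_image) (simp add: inj_on_def)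
  also have "\<dots> = (\<Sum>s\<in>steps d. card (walks d N (x - s)))"
  proof (rule card_UN_disjoint)
    show "\<forall>s\<in>steps d. \<forall>s'\<in>steps d. s \<noteq> s' \<longrightarrow> walks d N (x - s) \<inter> walks d N (x - s') = {}"
    proof (intro ballI impI)
      fix s s' :: "nat \<Rightarrow> int" assume "s \<noteq> s'"
      then have "x - s \<noteq> x - s'" by (auto simp: fun_eq_iff)
      then show "walks d N (x - s) \<inter> walks d N (x - s') = {}" by (auto simp: walks_def)
    qed
  qed (use assms finite_walks lattice_diff_step in auto)
  finally show ?thesis by (simp add: sum_steps)
qed

text \<open>The number of \<open>m\<close>-step walks in \<open>\<int>\<close> from \<open>0\<close> to \<open>z\<close>.\<close>

definition line_walks :: "nat \<Rightarrow> int \<Rightarrow> nat" where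
  "line_walks m z = (if even (int m + z) \<and> int m + z \<ge> 0 then m choose nat ((int m + z) div 2) else 0)"

lemma line_walks_0: "line_walks 0 z = of_bool (z = 0)"
  by (auto simp: line_walks_def elim!: evenE)

text \<open>Pascal's rule, where half of \<open>int m + z\<close> counts the steps to the right. At
  \<open>r = 0\<close> the neighbour \<open>z - 1\<close> is out of reach and contributes
  nothing.\<close>

lemma line_walks_Suc: "line_walks (Suc m) z = line_walks m (z - 1) + line_walks m (z + 1)"
proof (cases "even (int (Suc m) + z) \<and> int (Suc m) + z \<ge> 0")
  case False
  then have "odd (int m + (z - 1)) \<and> odd (int m + (z + 1)) \<or> int m + (z + 1) < 0" by auto
  then show ?thesis using False by (auto simp: line_walks_def)
next
  case True
  then obtain r where r: "int (Suc m) + z = 2 * r" "r \<ge> 0" by (metis evenE zero_le_mult_iff not_numeral_le_zero)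
  then have z: "int m + (z - 1) = 2 * (r - 1)" "int m + (z + 1) = 2 * r" by auto
  show ?thesis
  proof (cases "r = 0")
    case True
    then show ?thesis unfolding line_walks_def z r(1) by simp
  next
    case False
    then obtain k where "r = int (Suc k)" using r(2) by (metis nonneg_int_cases not0_implies_Suc of_nat_0)
    then have "nat r = Suc k" "nat (r - 1) = k" "r \<ge> 1" by auto
    then show ?thesis unfolding line_walks_def z r(1) by simp
  qed
qed

lemma line_walks_even_0: "line_walks (2 * m) 0 = (2 * m) choose m"
  by (simp add: line_walks_def)

lemma line_walks_odd_0: "odd m \<Longrightarrow> line_walks m 0 = 0"
  by (simp add: line_walks_def)

text \<open>A Leibniz rule: in a binomial convolution, raising the length shifts one of the two
  sequences. It mirrors the choice of coordinates for the last step.\<close>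

lemma pascal_convolution:
  fixes f g :: "nat \<Rightarrow> nat"
  shows "(\<Sum>k\<le>Suc N. (Suc N choose k) * f k * g (Suc N - k)) =
    (\<Sum>k\<le>N. (N choose k) * f (Suc k) * g (N - k)) + (\<Sum>k\<le>N. (N choose k) * f k * g (Suc (N - k)))"
proof -
  have "(\<Sum>k\<le>Suc N. (Suc N choose k) * f k * g (Suc N - k)) =
      f 0 * g (Suc N) + (\<Sum>k\<le>N. (Suc N choose Suc k) * f (Suc k) * g (N - k))"
    by (subst sum.atMost_Suc_shift) simp
  also have "(\<Sum>k\<le>N. (Suc N choose Suc k) * f (Suc k) * g (N - k)) =
     (\<Sum>k\<le>N. (N choose k) * f (Suc k) * g (N - k)) + (\<Sum>k\<le>N. (N choose Suc k) * f (Suc k) * g (N - k))"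
    by (simp add: algebra_simps sum.distrib)
  also have "f 0 * g (Suc N) + ((\<Sum>k\<le>N. (N choose k) * f (Suc k) * g (N - k)) +
      (\<Sum>k\<le>N. (N choose Suc k) * f (Suc k) * g (N - k))) =
      (\<Sum>k\<le>N. (N choose k) * f (Suc k) * g (N - k)) +
      (\<Sum>k\<le>Suc N. (N choose k) * f k * g (Suc N - k))"
    by (simp only: sum.atMost_Suc_shift) simp
  also have "(\<Sum>k\<le>Suc N. (N choose k) * f k * g (Suc N - k)) = (\<Sum>k\<le>N. (N choose k) * f k * g (Suc (N - k)))"
    by (simp add: Suc_diff_le)
  finally show ?thesis .
qed

text \<open>Choose which \<open>k\<close> of the \<open>N\<close> steps use the first
  \<open>d\<close> coordinates; the two projections are then independent walks. The induction
  removes the last step.\<close>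

lemma card_walks_split:
  "x \<in> lattice (Suc d) \<Longrightarrow>
   card (walks (Suc d) N x) = (\<Sum>k\<le>N. (N choose k) * card (walks d k (x(d := 0))) * line_walks (N - k) (x d))"
proof (induction N arbitrary: x)
  case 0
  define y where "y = x(d := 0)"
  have "y \<in> lattice d" using 0 by (auto simp: lattice_def y_def)
  moreover have "x = 0 \<longleftrightarrow> y = 0 \<and> x d = 0" by (auto simp: fun_eq_iff y_def)
  ultimately show ?case using 0 unfolding y_def[symmetric] by (auto simp: walks_0 line_walks_0)
next
  case (Suc N)
  define a where "a k y = card (walks d k y)" for k y
  let ?y = "x(d := 0)"
  have y: "?y \<in> lattice d" using Suc.prems by (auto simp: lattice_def)
  have lat: "x - unit_vec i \<in> lattice (Suc d)" "x + unit_vec i \<in> lattice (Suc d)" if "i < Suc d" for i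
    using Suc.prems that by (auto simp: lattice_def unit_vec_def)
  have upd: "(x - unit_vec i)(d := 0) = ?y - unit_vec i" "(x + unit_vec i)(d := 0) = ?y + unit_vec i"
     "(x - unit_vec i) d = x d" "(x + unit_vec i) d = x d" if "i < d" for i
    using that by (auto simp: fun_eq_iff unit_vec_def)
  have upd': "(x - unit_vec d)(d := 0) = ?y" "(x + unit_vec d)(d := 0) = ?y"
     "(x - unit_vec d) d = x d - 1" "(x + unit_vec d) d = x d + 1"
    by (auto simp: fun_eq_iff unit_vec_def)
  have "card (walks (Suc d) (Suc N) x) =
      (\<Sum>i<d. card (walks (Suc d) N (x - unit_vec i)) + card (walks (Suc d) N (x + unit_vec i))) +
      (card (walks (Suc d) N (x - unit_vec d)) + card (walks (Suc d) N (x + unit_vec d)))"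
    using card_walks_Suc[OF Suc.prems] by simp
  \<comment> \<open>Last step in one of the first \<open>d\<close> directions: the line walk in
    coordinate \<open>d\<close> is unaffected.\<close>
  also have "(\<Sum>i<d. card (walks (Suc d) N (x - unit_vec i)) + card (walks (Suc d) N (x + unit_vec i))) =
      (\<Sum>i<d. \<Sum>k\<le>N. (N choose k) * (a k (?y - unit_vec i) + a k (?y + unit_vec i)) * line_walks (N - k) (x d))"
  proof (intro sum.cong refl)
    fix i assume "i \<in> {..<d}"
    then have i: "i < d" "i < Suc d" by auto
    show "card (walks (Suc d) N (x - unit_vec i)) + card (walks (Suc d) N (x + unit_vec i)) =
      (\<Sum>k\<le>N. (N choose k) * (a k (?y - unit_vec i) + a k (?y + unit_vec i)) * line_walks (N - k) (x d))"
      unfolding Suc.IH[OF lat(1)[OF i(2)]] Suc.IH[OF lat(2)[OF i(2)]] upd[OF i(1)] a_def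
      by (simp add: algebra_simps sum.distrib)
  qed
  also have "\<dots> = (\<Sum>k\<le>N. (N choose k) * a (Suc k) ?y * line_walks (N - k) (x d))"
    unfolding a_def card_walks_Suc[OF y]
    by (subst sum.swap) (simp only: sum_distrib_left sum_distrib_right)
  \<comment> \<open>Last step in direction \<open>d\<close>: only the line walk gets longer.\<close>
  also have "card (walks (Suc d) N (x - unit_vec d)) + card (walks (Suc d) N (x + unit_vec d)) =
      (\<Sum>k\<le>N. (N choose k) * a k ?y * line_walks (Suc (N - k)) (x d))"
    unfolding Suc.IH[OF lat(1)[OF lessI]] Suc.IH[OF lat(2)[OF lessI]] upd' a_def line_walks_Suc
    by (simp add: algebra_simps sum.distrib)
  finally show ?case
    using pascal_convolution[of N "\<lambda>k. a k ?y" "\<lambda>m. line_walks m (x d)"] by (simp only: a_def)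
qed

lemma zero_in_lattice [simp]: "0 \<in> lattice d"
  by (simp add: lattice_def)

lemma W_eq_card_walks: "W d n = card (walks d (2 * n) 0)"
  by (simp add: W_def closed_walks_def walks_def)

text \<open>A line walk returns only after an even number of steps, so only even numbers of steps in
  the other coordinates count.\<close>

lemma W_Suc: "W (Suc d) n = (\<Sum>k\<le>n. ((2 * n) choose (2 * k)) * W d k * ((2 * (n - k)) choose (n - k)))"
proof -
  let ?f = "\<lambda>k. ((2 * n) choose k) * card (walks d k 0) * line_walks (2 * n - k) 0"
  have "(0 :: nat \<Rightarrow> int)(d := 0) = 0" by (simp add: fun_eq_iff)
  then have "W (Suc d) n = (\<Sum>k\<le>2 * n. ?f k)"
    unfolding W_eq_card_walks using card_walks_split[of 0 d "2 * n"] by simp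
  also have "\<dots> = (\<Sum>k\<in>(\<lambda>k. 2 * k) ` {..n}. ?f k)"
  proof (rule sum.mono_neutral_right)
    show "\<forall>i\<in>{..2 * n} - (\<lambda>k. 2 * k) ` {..n}. ?f i = 0"
    proof
      fix i assume i: "i \<in> {..2 * n} - (\<lambda>k. 2 * k) ` {..n}"
      have "odd i"
      proof
        assume "even i"
        then obtain j where "i = 2 * j" ..
        with i show False by auto
      qed
      then have "odd (2 * n - i)" using i by auto
      then show "?f i = 0" by (simp add: line_walks_odd_0)
    qed
  qed auto
  also have "\<dots> = (\<Sum>k\<le>n. ?f (2 * k))"
    by (simp add: sum.reindex inj_on_def)
  also have "\<dots> = (\<Sum>k\<le>n. ((2 * n) choose (2 * k)) * W d k * ((2 * (n - k)) choose (n - k)))"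
    by (simp only: W_eq_card_walks line_walks_even_0 flip: diff_mult_distrib2)
  finally show ?thesis .
qed

text \<open>Both sides equal (2n)! / (k!^2 (n - k)!^2).\<close>

lemma binomial_double_eq:
  assumes "k \<le> n"
  shows "((2 * n) choose (2 * k)) * ((2 * k) choose k) * ((2 * (n - k)) choose (n - k)) =
    ((2 * n) choose n) * (n choose k)\<^sup>2"
proof -
  have "real (((2 * n) choose (2 * k)) * ((2 * k) choose k) * ((2 * (n - k)) choose (n - k))) =
    real (((2 * n) choose n) * (n choose k)\<^sup>2)"
  proof -
    have "2 * n - n = n" "2 * k - k = k" "2 * (n - k) - (n - k) = n - k" "2 * n - 2 * k = 2 * (n - k)"
      by auto
    then show ?thesis using assms by (simp add: binomial_fact power2_eq_square)
  qed
  then show ?thesis by (simp only: of_nat_eq_iff)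
qed

text \<open>By \<open>binomial_double_eq\<close>, the factor \<open>(2 * n) choose n\<close> turns
  the recursion of \<open>V\<close> into that of \<open>W\<close>.\<close>

lemma W_eq: "W d n = ((2 * n) choose n) * V d n"
proof (induction d arbitrary: n)
  case 0
  show ?case
  proof (cases "n = 0")
    case True
    then show ?thesis by (simp add: W_eq_card_walks walks_0)
  next
    case False
    then obtain m where "2 * n = Suc m" by (cases n) auto
    then show ?thesis using False by (simp add: W_eq_card_walks card_walks_Suc)
  qed
next
  case (Suc d)
  have "W (Suc d) n = (\<Sum>k\<le>n. ((2 * n) choose n) * ((n choose k)\<^sup>2 * V d k))"
    unfolding W_Suc
  proof (intro sum.cong refl)
    fix k assume "k \<in> {..n}"
    then have k: "k \<le> n" by simp
    have "((2 * n) choose (2 * k)) * W d k * ((2 * (n - k)) choose (n - k)) =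
      (((2 * n) choose (2 * k)) * ((2 * k) choose k) * ((2 * (n - k)) choose (n - k))) * V d k"
      by (simp only: Suc.IH mult_ac)
    also have "\<dots> = ((2 * n) choose n) * ((n choose k)\<^sup>2 * V d k)"
      unfolding binomial_double_eq[OF k] by (rule mult.assoc)
    finally show "((2 * n) choose (2 * k)) * W d k * ((2 * (n - k)) choose (n - k)) = \<dots>" .
  qed
  then show ?case by (simp add: sum_distrib_left)
qed

section \<open>Valuations\<close>

lemma pow2_dvd_add_iff:
  fixes x y c :: nat
  assumes "x = 2 ^ a * c + y" "2 ^ (a + 1) dvd y"
  shows "2 ^ a dvd x \<and> (2 ^ (a + 1) dvd x \<longleftrightarrow> even c)"
proof -
  from assms(2) obtain z where "y = 2 ^ (a + 1) * z" ..
  with assms(1) have x: "x = 2 ^ a * (c + 2 * z)" by (simp add: algebra_simps)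
  have "2 ^ (a + 1) dvd x \<longleftrightarrow> 2 ^ a * 2 dvd 2 ^ a * (c + 2 * z)" by (simp add: x)
  also have "\<dots> \<longleftrightarrow> even (c + 2 * z)" by (rule nat_mult_dvd_cancel1) simp
  finally show ?thesis using x by simp
qed

text \<open>In \<open>V_4_alt\<close> every term but \<open>j = n div 2\<close> is divisible by the
  higher power. That term is \<open>2 ^ (2 * s2 n)\<close> times an odd number times
  \<open>(n + h) choose h\<close>, whose parity decides.\<close>

lemma V_4_dvd: "2 ^ (2 * s2 n) dvd V 4 n \<and> (2 ^ (2 * s2 n + 1) dvd V 4 n \<longleftrightarrow> \<not> sparse n)"
proof -
  define t where "t j = ((n + j) choose j) * (n choose (2 * j)) * ((2 * j) choose j)\<^sup>2 * 4 ^ (n - 2 * j)" for j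
  define h where "h = n div 2"
  have central: "2 ^ s2 j dvd (2 * j) choose j" for j
    by (metis multiplicity_central_binomial multiplicity_dvd)
  have small: "2 ^ (2 * s2 n + 1) dvd t j" if "j \<le> n" "j \<noteq> h" for j
  proof (cases "2 * j \<le> n")
    case False
    then have "n choose (2 * j) = 0" by simp
    then have "t j = 0" by (simp only: t_def mult_0_right mult_0)
    then show ?thesis by simp
  next
    case True
    then obtain m where m: "n = 2 * j + m" using le_Suc_ex by blast
    with that have "m \<ge> 2" by (auto simp: h_def)
    \<comment> \<open>Uses \<open>s2 n \<le> s2 j + s2 m\<close>, and \<open>s2 m < m\<close>
      because \<open>m \<ge> 2\<close>.\<close>
    then have "2 * s2 n + 1 \<le> s2 j * 2 + 2 * m"
      using s2_add_le[of "2 * j" m] s2_less[of m] by (simp add: m)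
    moreover have "2 ^ (s2 j * 2 + 2 * m) dvd ((2 * j) choose j)\<^sup>2 * 4 ^ m"
      using mult_dvd_mono[OF dvd_power_same[OF central[of j], of 2] dvd_refl[of "4 ^ m"]]
      by (simp add: power_add power_mult)
    ultimately have "2 ^ (2 * s2 n + 1) dvd ((2 * j) choose j)\<^sup>2 * 4 ^ m"
      using power_le_dvd by blast
    moreover have "t j = ((n + j) choose j) * (n choose (2 * j)) * (((2 * j) choose j)\<^sup>2 * 4 ^ m)"
      by (simp add: t_def m)
    ultimately show ?thesis by (simp only: dvd_mult)
  qed
  obtain q where q: "(2 * h) choose h = 2 ^ s2 h * q" using central[of h] ..
  have "odd q"
  proof
    assume "even q"
    then have "2 ^ Suc (s2 h) dvd (2 * h) choose h" unfolding q by (auto simp: mult_ac)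
    then have "Suc (s2 h) \<le> multiplicity 2 ((2 * h) choose h)"
      by (intro multiplicity_geI) auto
    then show False by (simp add: multiplicity_central_binomial)
  qed
  \<comment> \<open>For odd \<open>n\<close>, \<open>s2 n\<close> exceeds \<open>s2 h\<close> by
    one, and the remaining factor 4 makes up for it. The odd cofactor \<open>r\<close> is
    \<open>q\<^sup>2\<close> for even \<open>n\<close> and \<open>n * q\<^sup>2\<close> for odd
    \<open>n\<close>.\<close>
  have "\<exists>r. odd r \<and> t h = 2 ^ (2 * s2 n) * (r * ((n + h) choose h))"
  proof (cases n rule: nat_parity_cases)
    case (even m)
    then have "h = m" by (simp add: h_def)
    then have "t h = 2 ^ (2 * s2 n) * (q\<^sup>2 * ((n + h) choose h))"
      using q even by (simp add: t_def power_mult_distrib power_even_eq)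
    with \<open>odd q\<close> show ?thesis by (intro exI[of _ "q\<^sup>2"]) simp
  next
    case (odd m)
    then have "h = m" by (simp add: h_def)
    moreover have "n choose (2 * m) = n" using odd by simp
    ultimately have "t h = ((n + h) choose h) * n * (2 ^ s2 m * q)\<^sup>2 * 4"
      using q odd by (simp add: t_def)
    also have "\<dots> = 2 ^ (2 * s2 n) * ((n * q\<^sup>2) * ((n + h) choose h))"
    proof -
      have "s2 n = Suc (s2 m)" by (simp add: odd)
      then show ?thesis by (simp add: power_mult_distrib power_add power_even_eq)
    qed
    finally show ?thesis using \<open>odd q\<close> odd by (intro exI[of _ "n * q\<^sup>2"]) simp
  qed
  then obtain r where r: "odd r" "t h = 2 ^ (2 * s2 n) * (r * ((n + h) choose h))" by blast
  have "h \<in> {..n}" by (simp add: h_def)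
  have "V 4 n = 2 ^ (2 * s2 n) * (r * ((n + h) choose h)) + (\<Sum>j\<in>{..n} - {h}. t j)"
    unfolding V_4_alt t_def[symmetric] r(2)[symmetric]
    using \<open>h \<in> {..n}\<close> by (simp add: sum.remove)
  moreover have "2 ^ (2 * s2 n + 1) dvd (\<Sum>j\<in>{..n} - {h}. t j)"
    by (rule dvd_sum) (use small in auto)
  ultimately have "2 ^ (2 * s2 n) dvd V 4 n \<and> (2 ^ (2 * s2 n + 1) dvd V 4 n \<longleftrightarrow> even (r * ((n + h) choose h)))"
    by (rule pow2_dvd_add_iff)
  moreover have "odd ((n + h) choose h) \<longleftrightarrow> sparse n"
    using odd_binomial_iff[of h n] sparse_iff_carry_free[of n]
    by (simp add: h_def carry_free_def add.commute)
  ultimately show ?thesis using r(1) by auto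
qed

text \<open>The term \<open>k = n\<close> of \<open>V_add\<close> is \<open>V d n\<close>, as
  \<open>V e 0 = 1\<close>. Every other term gets the extra factor 2 from \<open>e\<close>, while
  subadditivity of \<open>s2\<close> secures the rest. Applied with \<open>t\<close> equal to 0, 1
  and 2.\<close>

lemma V_add_dvd:
  assumes d: "\<And>k. 2 ^ (t * s2 k) dvd V d k" and e: "\<And>k. k > 0 \<Longrightarrow> 2 ^ (t * s2 k + 1) dvd V e k"
  shows "2 ^ (t * s2 n) dvd V (d + e) n"
    and "2 ^ (t * s2 n + 1) dvd V (d + e) n \<longleftrightarrow> 2 ^ (t * s2 n + 1) dvd V d n"
proof -
  define y where "y = (\<Sum>k<n. (n choose k)\<^sup>2 * V d k * V e (n - k))"
  have V: "V (d + e) n = V d n + y"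
    by (simp add: V_add y_def flip: lessThan_Suc_atMost)
  have y: "2 ^ (t * s2 n + 1) dvd y"
    unfolding y_def
  proof (rule dvd_sum)
    fix k assume "k \<in> {..<n}"
    then have k: "k < n" by simp
    have "s2 n \<le> s2 k + s2 (n - k)" using s2_add_le[of k "n - k"] k by simp
    then have "t * s2 n + 1 \<le> t * s2 k + (t * s2 (n - k) + 1)"
      by (metis add.assoc add_le_mono1 distrib_left mult_le_mono2)
    then have "(2::nat) ^ (t * s2 n + 1) dvd 2 ^ (t * s2 k) * 2 ^ (t * s2 (n - k) + 1)"
      by (metis le_imp_power_dvd power_add)
    also have "\<dots> dvd V d k * V e (n - k)" using d e k by (intro mult_dvd_mono) auto
    finally show "2 ^ (t * s2 n + 1) dvd (n choose k)\<^sup>2 * V d k * V e (n - k)"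
      by (simp only: mult.assoc dvd_mult)
  qed
  then show "2 ^ (t * s2 n + 1) dvd V (d + e) n \<longleftrightarrow> 2 ^ (t * s2 n + 1) dvd V d n"
    unfolding V by (rule dvd_add_left_iff)
  from y have "2 ^ (t * s2 n) dvd y" by (rule power_le_dvd) simp
  then show "2 ^ (t * s2 n) dvd V (d + e) n" unfolding V using d by (rule dvd_add[rotated])
qed

lemma sum_symmetric:
  fixes g :: "nat \<Rightarrow> nat"
  assumes "\<And>k. k \<le> n \<Longrightarrow> g (n - k) = g k"
  shows "(\<Sum>k\<le>n. g k) = 2 * (\<Sum>k | 2 * k < n. g k) + (\<Sum>k | 2 * k = n. g k)"
proof -
  have fin: "finite {k. 2 * k < n}" "finite {k. 2 * k = n}" "finite {k. n < 2 * k \<and> k \<le> n}"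
    by (rule finite_subset[of _ "{..n}"]; auto)+
  have "{..n} = {k. 2 * k < n} \<union> {k. n < 2 * k \<and> k \<le> n} \<union> {k. 2 * k = n}"
    by auto
  then have "(\<Sum>k\<le>n. g k) = (\<Sum>k\<in>{k. 2 * k < n} \<union> {k. n < 2 * k \<and> k \<le> n} \<union> {k. 2 * k = n}. g k)"
    by simp
  also have "\<dots> = (\<Sum>k | 2 * k < n. g k) + (\<Sum>k | n < 2 * k \<and> k \<le> n. g k) + (\<Sum>k | 2 * k = n. g k)"
    using fin by (subst sum.union_disjoint; auto)+
  also have "(\<Sum>k | n < 2 * k \<and> k \<le> n. g k) = (\<Sum>k | 2 * k < n. g k)"
    by (rule sum.reindex_bij_witness[of _ "\<lambda>k. n - k" "\<lambda>k. n - k"]) (use assms in auto)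
  finally show ?thesis by simp
qed

text \<open>Terms off the middle occur in equal pairs, which doubles the modulus; the middle term
  occurs once and needs the doubled modulus from the start.\<close>

lemma cong_sum_symmetric:
  fixes g h :: "nat \<Rightarrow> nat"
  assumes "\<And>k. k \<le> n \<Longrightarrow> g (n - k) = g k" "\<And>k. k \<le> n \<Longrightarrow> h (n - k) = h k"
    and "\<And>k. k \<le> n \<Longrightarrow> [g k = h k] (mod m)" "\<And>k. 2 * k = n \<Longrightarrow> [g k = h k] (mod (2 * m))"
  shows "[(\<Sum>k\<le>n. g k) = (\<Sum>k\<le>n. h k)] (mod (2 * m))"
proof -
  have "[(\<Sum>k | 2 * k < n. g k) = (\<Sum>k | 2 * k < n. h k)] (mod m)"
    by (rule cong_sum) (use assms(3) in auto)
  then have "[2 * (\<Sum>k | 2 * k < n. g k) = 2 * (\<Sum>k | 2 * k < n. h k)] (mod (2 * m))"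
    by (simp only: cong_def mod_mult_mult1)
  moreover have "[(\<Sum>k | 2 * k = n. g k) = (\<Sum>k | 2 * k = n. h k)] (mod (2 * m))"
    by (rule cong_sum) (use assms(4) in auto)
  ultimately have "[2 * (\<Sum>k | 2 * k < n. g k) + (\<Sum>k | 2 * k = n. g k) =
      2 * (\<Sum>k | 2 * k < n. h k) + (\<Sum>k | 2 * k = n. h k)] (mod (2 * m))"
    by (rule cong_add)
  then show ?thesis using sum_symmetric[of n g] sum_symmetric[of n h] assms(1,2) by simp
qed

text \<open>
  By Kummer's theorem \<open>multiplicity 2 (n choose k)\<close> is the number of carries in \<open>k + (n - k)\<close>. The weight
  is what \<open>(n choose k)\<^sup>2\<close> becomes in the convolution of \<open>V d n / 4 ^ s2 n\<close>.
\<close>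

definition carry_weight :: "nat \<Rightarrow> nat \<Rightarrow> nat" where
  "carry_weight n k = 4 ^ multiplicity 2 (n choose k) * (n choose k)\<^sup>2"

lemma carry_weight_eq:
  assumes "k \<le> n"
  shows "(n choose k)\<^sup>2 * (4 ^ s2 k * 4 ^ s2 (n - k)) = 4 ^ s2 n * carry_weight n k"
proof -
  have "s2 k + s2 (n - k) = multiplicity 2 (n choose k) + s2 n"
    using multiplicity_binomial_plus_s2[of k "n - k"] assms by simp
  then have "(4::nat) ^ s2 k * 4 ^ s2 (n - k) = 4 ^ multiplicity 2 (n choose k) * 4 ^ s2 n"
    by (metis power_add)
  then show ?thesis by (simp add: carry_weight_def mult_ac)
qed

lemma carry_weight_sym: "k \<le> n \<Longrightarrow> carry_weight n (n - k) = carry_weight n k"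
  by (simp add: carry_weight_def flip: binomial_symmetric)

lemma carry_weight_0 [simp]: "carry_weight n 0 = 1"
  by (simp add: carry_weight_def)

lemma odd_carry_weight_iff:
  assumes "k \<le> n"
  shows "odd (carry_weight n k) \<longleftrightarrow> carry_free k (n - k)"
proof -
  have "multiplicity 2 (n choose k) = 0" if "odd (n choose k)"
    using that by (rule not_dvd_imp_multiplicity_0)
  then have "odd (carry_weight n k) \<longleftrightarrow> odd (n choose k)"
    by (auto simp: carry_weight_def)
  then show ?thesis using odd_binomial_iff[of k "n - k"] assms by simp
qed

lemma four_dvd_carry_weight_double: "k > 0 \<Longrightarrow> 4 dvd carry_weight (2 * k) k"
proof -
  assume "k > 0"
  then have "even ((2 * k) choose k)"
    using odd_binomial_iff[of k k] not_carry_free_self by (simp add: mult_2)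
  then have "2\<^sup>2 dvd ((2 * k) choose k)\<^sup>2" by (rule dvd_power_same)
  then show ?thesis by (simp add: carry_weight_def)
qed

lemma V_double:
  assumes "\<And>k. V d k = 4 ^ s2 k * u k"
  shows "V (2 * d) n = 4 ^ s2 n * (\<Sum>k\<le>n. carry_weight n k * (u k * u (n - k)))"
proof -
  have "V (2 * d) n = (\<Sum>k\<le>n. (n choose k)\<^sup>2 * V d k * V d (n - k))"
    using V_add[of d d n] by (simp add: mult_2)
  also have "\<dots> = (\<Sum>k\<le>n. (n choose k)\<^sup>2 * (4 ^ s2 k * 4 ^ s2 (n - k)) * (u k * u (n - k)))"
    unfolding assms by (simp only: mult_ac)
  also have "\<dots> = (\<Sum>k\<le>n. 4 ^ s2 n * (carry_weight n k * (u k * u (n - k))))"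
    by (intro sum.cong) (simp_all only: atMost_iff carry_weight_eq mult.assoc)
  finally show ?thesis by (simp only: sum_distrib_left)
qed

section \<open>Splitting the ones into two sets without adjacent ones\<close>

definition sparse_splits :: "nat \<Rightarrow> nat set" where
  "sparse_splits n = {k. k \<le> n \<and> carry_free k (n - k) \<and> sparse k \<and> sparse (n - k)}"

lemma finite_sparse_splits [simp]: "finite (sparse_splits n)"
  by (rule finite_subset[of _ "{..n}"]) (auto simp: sparse_splits_def)

lemma card_sparse_splits_0: "card (sparse_splits 0) = 1"
proof -
  have "sparse_splits 0 = {0}" by (auto simp: sparse_splits_def carry_free_def)
  then show ?thesis by simp
qed

text \<open>An odd \<open>k\<close> would make \<open>2 * m - k\<close> odd as well and cause a
  carry, so both halves are even.\<close>

lemma card_sparse_splits_double: "card (sparse_splits (2 * m)) = card (sparse_splits m)"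
proof -
  have "k \<in> sparse_splits (2 * m) \<longleftrightarrow> k \<in> (\<lambda>k. 2 * k) ` sparse_splits m" for k
  proof (cases k rule: nat_parity_cases)
    case (even a)
    have "2 * m - 2 * a = 2 * (m - a)" by simp
    then show ?thesis unfolding even by (auto simp: sparse_splits_def)
  next
    case (odd a)
    have "2 * m - Suc (2 * a) = Suc (2 * (m - a - 1))" if "Suc (2 * a) \<le> 2 * m" using that by linarith
    then have "k \<notin> sparse_splits (2 * m)" unfolding odd by (auto simp: sparse_splits_def)
    moreover have "Suc (2 * a) \<noteq> 2 * b" for b by presburger
    ultimately show ?thesis unfolding odd by auto
  qed
  then have "sparse_splits (2 * m) = (\<lambda>k. 2 * k) ` sparse_splits m" by blast
  then show ?thesis by (simp add: card_image inj_on_def)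
qed

text \<open>The new lowest one goes to either half, provided that this half does not already end in
  a one.\<close>

lemma sparse_splits_Suc_double:
  "sparse_splits (Suc (2 * m)) =
     (\<lambda>k. Suc (2 * k)) ` {k \<in> sparse_splits m. even k} \<union> (\<lambda>k. 2 * k) ` {k \<in> sparse_splits m. even (m - k)}"
    (is "_ = ?R")
proof -
  have "k \<in> sparse_splits (Suc (2 * m)) \<longleftrightarrow> k \<in> ?R" for k
  proof (cases k rule: nat_parity_cases)
    case (even a)
    have "Suc (2 * m) - 2 * a = Suc (2 * (m - a))" if "2 * a \<le> Suc (2 * m)" using that by linarith
    moreover have "2 * a \<le> Suc (2 * m) \<longleftrightarrow> a \<le> m" by linarith
    moreover have "2 * a \<noteq> Suc (2 * b)" for b by presburger
    ultimately show ?thesis unfolding even by (auto simp: sparse_splits_def)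
  next
    case (odd a)
    have "Suc (2 * m) - Suc (2 * a) = 2 * (m - a)" by simp
    moreover have "Suc (2 * a) \<noteq> 2 * b" for b by presburger
    ultimately show ?thesis unfolding odd by (auto simp: sparse_splits_def)
  qed
  then show ?thesis by blast
qed

text \<open>For odd \<open>m\<close> exactly one half ends in a one, so the new one is forced into
  the other. For even \<open>m\<close> both halves are even and either may receive it.\<close>

lemma card_sparse_splits_Suc_double:
  "card (sparse_splits (Suc (2 * m))) = (if odd m then card (sparse_splits m) else 2 * card (sparse_splits m))"
proof -
  let ?A = "{k \<in> sparse_splits m. even k}" and ?B = "{k \<in> sparse_splits m. even (m - k)}"
  have double_not_odd: "Suc (2 * k) \<noteq> 2 * l" for k l :: nat by presburger
  have "card (sparse_splits (Suc (2 * m))) = card ((\<lambda>k. Suc (2 * k)) ` ?A) + card ((\<lambda>k. 2 * k) ` ?B)"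
    unfolding sparse_splits_Suc_double by (rule card_Un_disjoint) (use double_not_odd in auto)
  also have "\<dots> = card ?A + card ?B"
    by (simp add: card_image inj_on_def)
  also have "\<dots> = (if odd m then card (sparse_splits m) else 2 * card (sparse_splits m))"
  proof (cases "odd m")
    case True
    have "card ?A + card ?B = card (?A \<union> ?B)"
      by (rule card_Un_disjoint[symmetric]) (use True in \<open>auto simp: sparse_splits_def\<close>)
    also have "?A \<union> ?B = sparse_splits m"
      using True by (auto simp: sparse_splits_def)
    finally show ?thesis using True by simp
  next
    case False
    have "even k \<and> even (m - k)" if "k \<in> sparse_splits m" for k
    proof -
      have "\<not> (odd k \<and> odd (m - k))" "k \<le> m"
        using that carry_free_rec[of k "m - k"] by (auto simp: sparse_splits_def)
      then show ?thesis using False by auto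
    qed
    then have "?A = sparse_splits m" "?B = sparse_splits m" by auto
    then show ?thesis using False by simp
  qed
  finally show ?thesis .
qed

text \<open>Within a run of ones the two halves alternate, so the cardinality is 2 to the number of
  runs. It is 2 modulo 4 exactly if there is a single run, which then leads.\<close>

lemma card_sparse_splits_dvd:
  "n > 0 \<Longrightarrow> even (card (sparse_splits n)) \<and> (4 dvd card (sparse_splits n) \<longleftrightarrow> \<not> leading_ones n)"
proof (induction n rule: parity_induct)
  case (even m)
  then show ?case by (simp add: card_sparse_splits_double leading_ones_double)
next
  case (odd m)
  \<comment> \<open>The appended one starts the first run, extends the last run, or opens a further
    run.\<close>
  consider "m = 0" | "odd m" | "m > 0" "even m" by fastforce
  then show ?case
  proof cases
    case 1
    have "card (sparse_splits (Suc (2 * 0))) = 2"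
      unfolding card_sparse_splits_Suc_double card_sparse_splits_0 by simp
    then show ?thesis using 1 leading_ones_1 by simp
  next
    case 2
    then show ?thesis
      using odd odd_pos[OF 2] by (simp add: card_sparse_splits_Suc_double leading_ones_Suc_double_odd)
  next
    case 3
    have "even (card (sparse_splits m))" using odd 3 by simp
    then have "4 dvd 2 * card (sparse_splits m)" by auto
    then show ?thesis
      using 3 leading_ones_Suc_double_even[of m] by (simp add: card_sparse_splits_Suc_double)
  qed
qed simp

lemma four_power_mult_dvd_iff:
  "2 ^ (2 * a + b) dvd (4 ^ a * x :: nat) \<longleftrightarrow> 2 ^ b dvd x"
proof -
  have "(2::nat) ^ (2 * a + b) = 4 ^ a * 2 ^ b" by (simp add: power_add power_mult)
  then show ?thesis by simp
qed

text \<open>With \<open>V d k = 4 ^ s2 k * u k\<close>, \<open>u k\<close> is odd exactly for sparse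
  \<open>k\<close>, so a term of \<open>V_double\<close> is odd exactly for \<open>k\<close> in
  \<open>sparse_splits n\<close>. The symmetry under \<open>k\<close> and \<open>n - k\<close> lifts
  this congruence to modulus 4.\<close>

lemma V_double_of_sparse:
  assumes d: "\<And>n. 2 ^ (2 * s2 n) dvd V d n \<and> (2 ^ (2 * s2 n + 1) dvd V d n \<longleftrightarrow> \<not> sparse n)"
    and n: "n > 0"
  shows "2 ^ (2 * s2 n + 1) dvd V (2 * d) n \<and> (2 ^ (2 * s2 n + 2) dvd V (2 * d) n \<longleftrightarrow> \<not> leading_ones n)"
proof -
  have "\<exists>u. V d k = 4 ^ s2 k * u" for k
    using d[of k] by (auto simp: power_mult)
  then obtain u where u: "\<And>k. V d k = 4 ^ s2 k * u k" by metis
  have odd_u: "odd (u k) \<longleftrightarrow> sparse k" for k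
    using d[of k] four_power_mult_dvd_iff[of "s2 k" 1 "u k"] u[of k] by auto
  let ?g = "\<lambda>k. carry_weight n k * (u k * u (n - k))"
  let ?h = "\<lambda>k. of_bool (k \<in> sparse_splits n) :: nat"
  have cong_2: "[a = b] (mod 2)" if "odd a \<longleftrightarrow> odd b" for a b :: nat
    using that by (simp add: cong_def mod2_eq_if)
  have "[(\<Sum>k\<le>n. ?g k) = (\<Sum>k\<le>n. ?h k)] (mod (2 * 2))"
  proof (rule cong_sum_symmetric)
    fix k assume k: "k \<le> n"
    then show "carry_weight n (n - k) * (u (n - k) * u (n - (n - k))) = ?g k"
      by (simp add: carry_weight_sym)
    show "?h (n - k) = ?h k"
      using k by (auto simp: sparse_splits_def carry_free_def add.commute)
    have "odd (?g k) \<longleftrightarrow> odd (?h k)"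
      using k by (auto simp: odd_carry_weight_iff odd_u sparse_splits_def)
    then show "[?g k = ?h k] (mod 2)" by (rule cong_2)
  next
    \<comment> \<open>The middle term vanishes modulo 4, because adding \<open>k\<close> to itself
      carries.\<close>
    fix k assume k: "2 * k = n"
    then have "n - k = k" "k > 0" using n by auto
    then have "4 dvd ?g k" using four_dvd_carry_weight_double[of k] k by auto
    moreover have "k \<notin> sparse_splits n"
      using not_carry_free_self[of k] \<open>n - k = k\<close> \<open>k > 0\<close> by (simp add: sparse_splits_def)
    ultimately show "[?g k = ?h k] (mod (2 * 2))" by (simp add: cong_0_iff)
  qed
  also have "(\<Sum>k\<le>n. ?h k) = card (sparse_splits n)"
    by (auto simp: sparse_splits_def sum.If_cases of_bool_def Int_def intro: arg_cong[of _ _ card])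
  finally have cong: "[(\<Sum>k\<le>n. ?g k) = card (sparse_splits n)] (mod 4)" by simp
  then have "4 dvd (\<Sum>k\<le>n. ?g k) \<longleftrightarrow> 4 dvd card (sparse_splits n)" by (rule cong_dvd_iff)
  moreover have "even (\<Sum>k\<le>n. ?g k) \<longleftrightarrow> even (card (sparse_splits n))"
    by (rule cong_dvd_iff[OF cong_dvd_modulus_nat[OF cong]]) simp
  ultimately show ?thesis
    using card_sparse_splits_dvd[OF n] four_power_mult_dvd_iff[of "s2 n" 1] four_power_mult_dvd_iff[of "s2 n" 2]
    by (simp add: V_double[OF u])
qed

text \<open>Since \<open>u 0 = 1\<close>, the two end terms give \<open>2 * u n\<close>. An inner
  term contains two factors divisible by \<open>2 ^ e\<close>, hence \<open>2 ^ Suc e\<close> as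
  \<open>e > 0\<close>, and pairing adds another factor 2.\<close>

lemma V_double_of_leading_ones:
  assumes d: "\<And>n. n > 0 \<Longrightarrow> 2 ^ (2 * s2 n + e) dvd V d n \<and> (2 ^ (2 * s2 n + Suc e) dvd V d n \<longleftrightarrow> \<not> leading_ones n)"
    and e: "e > 0" and n: "n > 0"
  shows "2 ^ (2 * s2 n + Suc e) dvd V (2 * d) n \<and>
    (2 ^ (2 * s2 n + Suc (Suc e)) dvd V (2 * d) n \<longleftrightarrow> \<not> leading_ones n)"
proof -
  have "\<exists>u. V d k = 4 ^ s2 k * u" for k
  proof (cases "k = 0")
    case False
    then have "4 ^ s2 k dvd V d k"
      using d[of k] by (auto simp: power_add power_mult intro: dvd_mult_left)
    then show ?thesis by (auto simp: dvd_def)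
  qed simp
  then obtain u where u: "\<And>k. V d k = 4 ^ s2 k * u k" by metis
  have u0: "u 0 = 1" using u[of 0] by simp
  have ue: "2 ^ e dvd u k" if "k > 0" for k
    using d[OF that] by (simp add: u four_power_mult_dvd_iff)
  have un: "2 ^ Suc e dvd u n \<longleftrightarrow> \<not> leading_ones n"
    using d[OF n] by (simp only: u four_power_mult_dvd_iff)
  let ?g = "\<lambda>k. carry_weight n k * (u k * u (n - k))"
  let ?h = "\<lambda>k. if k = 0 \<or> k = n then u n else 0"
  have inner: "2 ^ Suc e dvd u k * u (n - k)" if "0 < k" "k < n" for k
  proof -
    have "(2::nat) ^ Suc e dvd 2 ^ e * 2 ^ e"
      using e by (simp only: flip: power_add) (rule le_imp_power_dvd, simp)
    also have "\<dots> dvd u k * u (n - k)" using ue that by (intro mult_dvd_mono) auto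
    finally show ?thesis .
  qed
  have "[(\<Sum>k\<le>n. ?g k) = (\<Sum>k\<le>n. ?h k)] (mod (2 * 2 ^ Suc e))"
  proof (rule cong_sum_symmetric)
    fix k assume k: "k \<le> n"
    then show sym: "carry_weight n (n - k) * (u (n - k) * u (n - (n - k))) = ?g k"
      by (simp add: carry_weight_sym)
    show "?h (n - k) = ?h k" using k by auto
    consider "k = 0" | "k = n" | "0 < k" "k < n" using k by linarith
    then show "[?g k = ?h k] (mod 2 ^ Suc e)"
    proof cases
      case 2
      then show ?thesis using carry_weight_sym[of 0 n] u0 by simp
    next
      case 3
      then show ?thesis using inner[of k] by (auto simp: cong_0_iff)
    qed (simp add: u0)
  next
    fix k assume k: "2 * k = n"
    then have "n - k = k" "0 < k" "k < n" using n by auto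
    \<comment> \<open>The middle term has no partner; its even weight supplies the missing factor
      2.\<close>
    then have "2 dvd carry_weight n k"
      using four_dvd_carry_weight_double[of k] k by (auto elim!: dvd_trans[rotated])
    then have "2 * 2 ^ Suc e dvd ?g k"
      using inner[of k] \<open>0 < k\<close> \<open>k < n\<close> by (intro mult_dvd_mono) auto
    then show "[?g k = ?h k] (mod (2 * 2 ^ Suc e))"
      using \<open>0 < k\<close> \<open>k < n\<close> by (simp add: cong_0_iff)
  qed
  also have "(\<Sum>k\<le>n. ?h k) = (\<Sum>k\<in>{0, n}. ?h k)"
    by (rule sum.mono_neutral_right) auto
  also have "\<dots> = 2 * u n" using n by simp
  finally have cong: "[(\<Sum>k\<le>n. ?g k) = 2 * u n] (mod 2 ^ Suc (Suc e))" by simp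
  then have "2 ^ Suc (Suc e) dvd (\<Sum>k\<le>n. ?g k) \<longleftrightarrow> 2 ^ Suc (Suc e) dvd 2 * u n" by (rule cong_dvd_iff)
  then have "2 ^ Suc (Suc e) dvd (\<Sum>k\<le>n. ?g k) \<longleftrightarrow> \<not> leading_ones n" using un by simp
  moreover have "2 ^ Suc e dvd (\<Sum>k\<le>n. ?g k) \<longleftrightarrow> 2 ^ Suc e dvd 2 * u n"
    by (rule cong_dvd_iff[OF cong_dvd_modulus_nat[OF cong]]) simp
  moreover have "2 ^ Suc e dvd 2 * u n" using ue[OF n] by simp
  ultimately show ?thesis by (simp only: V_double[OF u] four_power_mult_dvd_iff)
qed

section \<open>The four cases for the valuation of \<open>d\<close>\<close>

lemma odd_V: "odd (V (2 * m + 1) n)"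
proof (induction m arbitrary: n)
  case 0
  show ?case by (simp only: V_1 mult_0_right add_0 One_nat_def) simp
next
  case (Suc m)
  have "even (V 2 k)" if "k > 0" for k
    using V_2 odd_binomial_iff[of k k] not_carry_free_self[OF that] by (simp add: mult_2)
  then have "even (V (2 * m + 1 + 2) n) \<longleftrightarrow> even (V (2 * m + 1) n)"
    using V_add_dvd(2)[of 0 "2 * m + 1" 2 n] by simp
  then show ?case using Suc[of n] by (simp add: add_ac)
qed

lemma V_2_mod_4_dvd: "2 ^ s2 n dvd V (4 * m + 2) n \<and> \<not> 2 ^ (s2 n + 1) dvd V (4 * m + 2) n"
proof (induction m arbitrary: n)
  case 0
  have "2 ^ k dvd V 2 n \<longleftrightarrow> k \<le> s2 n" for k
    using power_dvd_iff_le_multiplicity[of "V 2 n" 2 k] V_pos[of 2 n]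
    by (simp add: V_2 multiplicity_central_binomial)
  then show ?case by (simp only: mult_0_right add_0) simp
next
  case (Suc m)
  \<comment> \<open>Twice \<open>s2 k\<close> is at least \<open>s2 k + 1\<close>, since
    \<open>s2 k\<close> is positive.\<close>
  have "2 ^ (1 * s2 k + 1) dvd V 4 k" if "k > 0" for k
    using conjunct1[OF V_4_dvd[of k]] by (rule power_le_dvd) (use s2_pos[OF that] in simp)
  then have "2 ^ s2 n dvd V (4 * m + 2 + 4) n"
    "2 ^ (s2 n + 1) dvd V (4 * m + 2 + 4) n \<longleftrightarrow> 2 ^ (s2 n + 1) dvd V (4 * m + 2) n"
    using V_add_dvd[of 1 "4 * m + 2" 4 n] Suc by simp_all
  then show ?case using Suc[of n] by (simp add: add_ac)
qed

lemma V_4_mod_8_dvd: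
  "2 ^ (2 * s2 n) dvd V (8 * m + 4) n \<and> (2 ^ (2 * s2 n + 1) dvd V (8 * m + 4) n \<longleftrightarrow> \<not> sparse n)"
proof (induction m arbitrary: n)
  case 0
  then show ?case using V_4_dvd[of n] by simp
next
  case (Suc m)
  \<comment> \<open>Doubling from 4 to 8 already yields the extra factor 2 for adding 8.\<close>
  have "2 ^ (2 * s2 k + 1) dvd V 8 k" if "k > 0" for k
    using V_double_of_sparse[OF V_4_dvd that] by simp
  then have "2 ^ (2 * s2 n) dvd V (8 * m + 4 + 8) n"
    "2 ^ (2 * s2 n + 1) dvd V (8 * m + 4 + 8) n \<longleftrightarrow> 2 ^ (2 * s2 n + 1) dvd V (8 * m + 4) n"
    using V_add_dvd[of 2 "8 * m + 4" 8 n] Suc by simp_all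
  then show ?case using Suc[of n] by (simp add: add_ac)
qed

text \<open>The base case doubles an odd multiple of 4, where the criterion changes from
  \<open>sparse\<close> to \<open>leading_ones\<close>; each later doubling keeps the criterion and
  adds one to the exponent.\<close>

lemma V_0_mod_8_dvd:
  assumes "odd m" "n > 0"
  shows "2 ^ (2 * s2 n + Suc e) dvd V (2 ^ (e + 3) * m) n \<and>
    (2 ^ (2 * s2 n + Suc (Suc e)) dvd V (2 ^ (e + 3) * m) n \<longleftrightarrow> \<not> leading_ones n)"
  using \<open>n > 0\<close>
proof (induction e arbitrary: n)
  case 0
  from \<open>odd m\<close> obtain l where "m = 2 * l + 1" by (rule oddE)
  then have "2 ^ (0 + 3) * m = 2 * (8 * l + 4)" by simp
  then show ?case using V_double_of_sparse[OF V_4_mod_8_dvd \<open>n > 0\<close>, of l]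
    by simp
next
  case (Suc e)
  have "2 ^ (Suc e + 3) * m = 2 * (2 ^ (e + 3) * m)" by (simp only: add_Suc power_Suc mult.assoc)
  then show ?case
    using V_double_of_leading_ones[OF Suc.IH _ Suc.prems] by (simp only: zero_less_Suc)
qed

lemma multiplicity_2_iff:
  fixes x :: nat
  assumes "x > 0" "2 ^ a dvd x \<and> (2 ^ Suc a dvd x \<longleftrightarrow> P)"
  shows "multiplicity 2 x \<ge> a \<and> (multiplicity 2 x = a \<longleftrightarrow> \<not> P)"
  using assms power_dvd_iff_le_multiplicity[of x 2] by (auto simp del: power_Suc)

lemma w_eq: "d > 0 \<Longrightarrow> w d n = s2 n + multiplicity 2 (V d n)"
  using V_pos[of d n]
  by (simp add: w_def W_eq prime_elem_multiplicity_mult_distrib multiplicity_central_binomial)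

theorem mainTheorem1:
  fixes d n :: nat
  assumes "d > 0" and "n > 0"
  shows
    "(multiplicity 2 d = 0 \<longrightarrow> w d n = s2 n) \<and>
     (multiplicity 2 d = 1 \<longrightarrow> w d n = 2 * s2 n) \<and>
     (multiplicity 2 d = 2 \<longrightarrow>
        w d n \<ge> 3 * s2 n \<and>
        (w d n = 3 * s2 n \<longleftrightarrow> \<not> has_adjacent_ones (binary_expansion n))) \<and>
     (multiplicity 2 d \<ge> 3 \<longrightarrow>
        (let \<delta> = multiplicity 2 d - 2 in
           w d n \<ge> 3 * s2 n + \<delta> \<and>
           (w d n = 3 * s2 n + \<delta> \<longleftrightarrow> ones_before_zeros (binary_expansion n))))"
proof -
  note pos = V_pos[OF assms(1), of n]
  obtain m where dm: "d = 2 ^ multiplicity 2 d * m" "odd m"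
    using assms(1) by (metis multiplicity_decompose' not_less0 not_prime_unit two_is_prime_nat)
  from \<open>odd m\<close> obtain l where l: "m = 2 * l + 1" by (rule oddE)
  have "w d n = s2 n" if "multiplicity 2 d = 0"
  proof -
    have "d = 2 * l + 1" using dm(1) that l by simp
    then have "odd (V d n)" using odd_V[of l n] by simp
    then show ?thesis using w_eq[OF assms(1)] by (simp add: not_dvd_imp_multiplicity_0)
  qed
  moreover have "w d n = 2 * s2 n" if "multiplicity 2 d = 1"
  proof -
    have "d = 4 * l + 2" using dm(1) that l by simp
    \<comment> \<open>Taking \<open>False\<close> as the condition for the higher power makes
      equality unconditional.\<close>
    then have "multiplicity 2 (V d n) = s2 n"
      using multiplicity_2_iff[OF pos, of "s2 n" False] V_2_mod_4_dvd[of n l] by simp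
    then show ?thesis using w_eq[OF assms(1)] by simp
  qed
  moreover have "w d n \<ge> 3 * s2 n \<and>
      (w d n = 3 * s2 n \<longleftrightarrow> \<not> has_adjacent_ones (binary_expansion n))" if "multiplicity 2 d = 2"
  proof -
    have "d = 8 * l + 4" using dm(1) that l by simp
    then have "multiplicity 2 (V d n) \<ge> 2 * s2 n \<and> (multiplicity 2 (V d n) = 2 * s2 n \<longleftrightarrow> sparse n)"
      using multiplicity_2_iff[OF pos, of "2 * s2 n" "\<not> sparse n"] V_4_mod_8_dvd[of n l] by simp
    then show ?thesis using w_eq[OF assms(1)] by (auto simp: sparse_def)
  qed
  moreover have "w d n \<ge> 3 * s2 n + (multiplicity 2 d - 2) \<and>
      (w d n = 3 * s2 n + (multiplicity 2 d - 2) \<longleftrightarrow> ones_before_zeros (binary_expansion n))"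
    if "multiplicity 2 d \<ge> 3"
  proof -
    \<comment> \<open>With this offset the \<delta> of the statement is
      \<open>Suc e\<close>.\<close>
    define e where "e = multiplicity 2 d - 3"
    have e: "multiplicity 2 d = e + 3" using that by (simp add: e_def)
    then have "d = 2 ^ (e + 3) * m" using dm(1) by simp
    then have "multiplicity 2 (V d n) \<ge> 2 * s2 n + Suc e \<and>
        (multiplicity 2 (V d n) = 2 * s2 n + Suc e \<longleftrightarrow> leading_ones n)"
      using multiplicity_2_iff[OF pos, of "2 * s2 n + Suc e" "\<not> leading_ones n"]
        V_0_mod_8_dvd[OF \<open>odd m\<close> assms(2), of e] by simp
    then show ?thesis using w_eq[OF assms(1)] e by (auto simp: leading_ones_def)
  qed
  ultimately show ?thesis by (simp add: Let_def)
qed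

end
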